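(* For every $n\ge2$, the map $\phi$ defined below is a bijection of $\mathrm{And}_n^{I}$ onto $\mathrm{And}_n^{II}$, and for every $w\in\mathrm{And}_n^{I}$, $(\mathbf{F}\,w,\ \mathbf{spi}\,w,\ \mathbf{NL}\,w)=(\mathbf{pit}\,\phi(w),\ \mathbf{L}\,\phi(w),\ \mathbf{grn}\,\phi(w))$.
   Context: Words $w=x_1\cdots x_n$ are permutations of finite sets $X$ of positive integers. Andr\'e permutations: the empty word $e$ and one-letter words are Andr\'e I and II; for $|X|\ge2$ write $w=v\,\min(w)\,v'$; $w$ is Andr\'e I (resp. II) if $v,v'$ are Andr\'e I (resp. II) and $\max(vv')$ (resp. $\min(vv')$) is a letter of $v'$. $\mathrm{And}_X^{I}$ etc.; $\mathrm{And}_n^{I}$, $\mathrm{And}_n^{II}$ for $X=\{1,\dots,n\}$. Statistics ($n\ge2$): $\mathbf{F}\,w=x_1$; $\mathbf{L}\,w=x_n$; $\mathbf{NL}\,w=x_{n-1}$; $\mathbf{grn}\,w=\max\{x_{i-1},x_{i+1}\}$ where $x_i$ is the maximum letter, with $x_0=x_{n+1}=0$; $\mathbf{spi}\,w$ is the letter $x_i$ such that $x_1\le x_j$ for all $j\le i$ and $x_1>x_{i+1}$ (convention $x_{n+1}=0$); $\mathbf{pit}\,w$, for words with $x_{n-1}<x_n$: if $w$ ends with its maximum letter, $\mathbf{pit}\,w=\min(w)$; otherwise write $w=w_1\,\min(w)\,w_2$ and set $\mathbf{pit}\,w=\mathbf{pit}\,w_2$. Definition of $\phi$ on $\mathrm{And}_X^{I}$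 (recursive), where $X=\{a_1<a_2<\cdots<a_n\}$: $\phi(e)=e$, $\phi(a_1)=a_1$, $\phi(a_1a_2)=a_1a_2$. For $n\ge3$, each $w\in\mathrm{And}_X^I$ has either the form (i) $w=v_0\,a_1\,v_1\,a_2\,v_2$ or (ii) $w=v_0\,a_2\,v_2\,a_1\,v_1$ with factors $v_0,v_1,v_2$ (possibly empty words); in both cases $\phi(w)=\phi(v_1)\,a_1\,\phi(v_0\,a_2\,v_2)$. *)

theory Defs
  imports Main
begin

inductive andre_I :: "nat list \<Rightarrow> bool" where
  empty: "andre_I []"
| single: "andre_I [x]"
| split: "\<lbrakk>distinct (v @ m # v'); v @ v' \<noteq> []; m = Min (set (v @ m # v'));
           andre_I v; andre_I v'; Max (set (v @ v')) \<in> set v'\<rbrakk>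
         \<Longrightarrow> andre_I (v @ m # v')"

inductive andre_II :: "nat list \<Rightarrow> bool" where
  empty: "andre_II []"
| single: "andre_II [x]"
| split: "\<lbrakk>distinct (v @ m # v'); v @ v' \<noteq> []; m = Min (set (v @ m # v'));
           andre_II v; andre_II v'; Min (set (v @ v')) \<in> set v'\<rbrakk>
         \<Longrightarrow> andre_II (v @ m # v')"

definition And_I :: "nat set \<Rightarrow> nat list set" where
  "And_I X = {w. distinct w \<and> set w = X \<and> andre_I w}"

definition And_II :: "nat set \<Rightarrow> nat list set" where
  "And_II X = {w. distinct w \<and> set w = X \<and> andre_II w}"

text \<open>
  The letter \<open>x\<^sub>i\<close> of \<open>w = x\<^sub>1 \<dots> x\<^sub>n\<close>, indexed from 1, with the convention
  \<open>x\<^sub>0 = x\<^bsub>n+1\<^esub> = 0\<close>.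
\<close>

definition letter :: "nat list \<Rightarrow> nat \<Rightarrow> nat" where
  "letter w i = (if 1 \<le> i \<and> i \<le> length w then w ! (i - 1) else 0)"

definition stat_F :: "nat list \<Rightarrow> nat" where
  "stat_F w = letter w 1"

definition stat_L :: "nat list \<Rightarrow> nat" where
  "stat_L w = letter w (length w)"

definition stat_NL :: "nat list \<Rightarrow> nat" where
  "stat_NL w = letter w (length w - 1)"

definition stat_grn :: "nat list \<Rightarrow> nat" where
  "stat_grn w =
     (let i = (THE i. 1 \<le> i \<and> i \<le> length w \<and> letter w i = Max (set w))
      in max (letter w (i - 1)) (letter w (i + 1)))"

definition stat_spi :: "nat list \<Rightarrow> nat" where
  "stat_spi w =
     letter w (THE i. 1 \<le> i \<and> i \<le> length w \<and>
       (\<forall>j\<in>{1..i}. letter w 1 \<le> letter w j) \<and> letter w 1 > letter w (i + 1))"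

text \<open>
  If \<open>a\<close> occurs exactly once in \<open>w\<close>, then \<open>w = before a w @ a # after a w\<close>.
\<close>

definition before :: "nat \<Rightarrow> nat list \<Rightarrow> nat list" where
  "before a w = takeWhile (\<lambda>x. x \<noteq> a) w"

definition after :: "nat \<Rightarrow> nat list \<Rightarrow> nat list" where
  "after a w = tl (dropWhile (\<lambda>x. x \<noteq> a) w)"

lemma before_after: "a \<in> set w \<Longrightarrow> w = before a w @ a # after a w"
  unfolding before_def after_def by (induction w) auto

lemma before_append: "a \<notin> set u \<Longrightarrow> before a (u @ a # v) = u"
  unfolding before_def by (induction u) auto

lemma after_append: "a \<notin> set u \<Longrightarrow> after a (u @ a # v) = v"
  unfolding after_def by (induction u) auto

lemma length_before_after:
  "a \<in> set w \<Longrightarrow> length w = Suc (length (before a w) + length (after a w))"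
  using arg_cong[OF before_after, of a w length] by simp

text \<open>
  The statistic pit is only meant for words whose last letter exceeds the one before it. For
  such a word, the recursive call is on a nonempty word; this may be a one-letter word, whose
  only letter is then the result. The value on the empty word is arbitrary.
\<close>

function (sequential) stat_pit :: "nat list \<Rightarrow> nat" where
  "stat_pit [] = 0"
| "stat_pit w = (if last w = Max (set w) then Min (set w)
                 else stat_pit (after (Min (set w)) w))"
  by pat_completeness auto
termination
proof (relation "measure length", goal_cases)
  case 1
  show ?case by simp
next
  case (2 x xs)
  have "Min (set (x # xs)) \<in> set (x # xs)"
    by (rule Min_in) auto
  from length_before_after[OF this] show ?case
    by (simp del: length_Cons)
qed

text \<open>
  The case split is on whether the second smallest letter \<open>a2\<close> stands to the right or to the
  left of the smallest letter \<open>a1\<close>. The map is only meant for words in \<open>And_I X\<close>; on words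
  with a repeated letter it is set to the identity so that the recursion terminates. The
  equations \<open>phi_right\<close> and \<open>phi_left\<close> below give the two cases in terms of factorizations.
\<close>

function phi :: "nat list \<Rightarrow> nat list" where
  "phi w =
     (if length w \<le> 2 \<or> \<not> distinct w then w
      else
        let a1 = Min (set w); a2 = Min (set w - {a1});
            l = before a1 w; r = after a1 w
        in if a2 \<in> set r
           then phi (before a2 r) @ a1 # phi (l @ a2 # after a2 r)
           else phi r @ a1 # phi (before a2 l @ a2 # after a2 l))"
  by pat_completeness auto

lemma two_smallest:
  assumes "2 < length w" "distinct w" "a1 = Min (set w)" "a2 = Min (set w - {a1})"
  shows "a1 \<in> set w" "a2 \<in> set w" "a2 \<noteq> a1"
proof -
  have c: "card (set w) = length w"
    using assms by (simp add: distinct_card)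
  have "set w \<noteq> {}"
    using assms by auto
  then show a1: "a1 \<in> set w"
    using assms by simp
  have "card (set w - {a1}) > 0"
    using a1 c assms by simp
  then have "set w - {a1} \<noteq> {}"
    by (metis card.empty less_irrefl)
  then have "a2 \<in> set w - {a1}"
    unfolding assms(4) by (intro Min_in) auto
  then show "a2 \<in> set w" "a2 \<noteq> a1"
    by auto
qed

termination
proof (relation "measure length", goal_cases)
  case 1
  show ?case by simp
next
  case (2 w a1 a2 l r)
  then have m: "a1 \<in> set w"
    using two_smallest[of w a1 a2] by auto
  show ?case
    using 2 length_before_after[OF m] length_before_after[of a2 r] by auto
next
  case (3 w a1 a2 l r)
  then have m: "a1 \<in> set w"
    using two_smallest[of w a1 a2] by auto
  show ?case
    using 3 length_before_after[OF m] length_before_after[of a2 r] by auto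
next
  case (4 w a1 a2 l r)
  then have m: "a1 \<in> set w"
    using two_smallest[of w a1 a2] by auto
  show ?case
    using 4 length_before_after[OF m] by auto
next
  case (5 w a1 a2 l r)
  then have m: "a1 \<in> set w" "a2 \<in> set w" "a2 \<noteq> a1"
    using two_smallest[of w a1 a2] by auto
  then have "a2 \<in> set l"
    using 5 before_after[OF m(1)] by (metis Un_iff set_ConsD set_append)
  then show ?case
    using 5 length_before_after[OF m(1)] length_before_after[of a2 l] by auto
qed

declare phi.simps [simp del]

lemma phi_short: "length w \<le> 2 \<Longrightarrow> phi w = w"
  by (simp add: phi.simps)

lemma Min_two:
  assumes "set w = insert a1 (insert a2 B)" "a1 < a2" "\<forall>x\<in>B. a2 < x"
  shows "Min (set w) = a1" "Min (set w - {a1}) = a2"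
proof -
  have fin: "finite B"
    using assms(1) by (metis finite_insert List.finite_set)
  show "Min (set w) = a1"
    by (rule Min_eqI) (use assms fin in \<open>auto dest: less_imp_le order.strict_trans\<close>)
  show "Min (set w - {a1}) = a2"
    by (rule Min_eqI) (use assms fin in \<open>auto dest: less_imp_le\<close>)
qed

lemma phi_right:
  assumes "w = v0 @ a1 # v1 @ a2 # v2" "distinct w" "3 \<le> length w"
    and "a1 < a2" "\<forall>x \<in> set (v0 @ v1 @ v2). a2 < x"
  shows "phi w = phi v1 @ a1 # phi (v0 @ a2 # v2)"
proof -
  have "set w = insert a1 (insert a2 (set (v0 @ v1 @ v2)))"
    using assms(1) by auto
  note m = Min_two[OF this assms(4,5)]
  have b: "before a1 w = v0" "after a1 w = v1 @ a2 # v2"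
    using assms(1,2) by (auto simp: before_append after_append)
  have c: "before a2 (v1 @ a2 # v2) = v1" "after a2 (v1 @ a2 # v2) = v2"
    using assms(1,2) by (auto simp: before_append after_append)
  show ?thesis
    using assms(2,3) by (subst phi.simps) (simp add: Let_def m b c)
qed

lemma phi_left:
  assumes "w = v0 @ a2 # v2 @ a1 # v1" "distinct w" "3 \<le> length w"
    and "a1 < a2" "\<forall>x \<in> set (v0 @ v1 @ v2). a2 < x"
  shows "phi w = phi v1 @ a1 # phi (v0 @ a2 # v2)"
proof -
  have "set w = insert a1 (insert a2 (set (v0 @ v1 @ v2)))"
    using assms(1) by auto
  note m = Min_two[OF this assms(4,5)]
  have w: "w = (v0 @ a2 # v2) @ a1 # v1"
    using assms(1) by simp
  have b: "before a1 w = v0 @ a2 # v2" "after a1 w = v1"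
    unfolding w by (rule before_append after_append; use w assms(2) in auto)+
  have c: "before a2 (v0 @ a2 # v2) = v0" "after a2 (v0 @ a2 # v2) = v2"
    using assms(1,2) by (auto simp: before_append after_append)
  have "a2 \<notin> set v1"
    using assms(1,2) by auto
  then show ?thesis
    using assms(2,3) by (subst phi.simps) (simp add: Let_def m b c)
qed

end

theory Submission
  imports Defs
begin

text \<open>
  An Andre I word with at least two letters is determined by \<open>v1\<close> and \<open>v0 @ a2 # v2\<close>: in form (i)
  of the definition of \<open>phi\<close> its maximum lies in \<open>a2 # v2\<close>, in form (ii) it lies in \<open>v1\<close>, so the
  position of the maximum recovers the form. Conversely, every pair of Andre I words
  \<open>v1\<close>, \<open>v0 @ a2 # v2\<close> arises in this way, provided that \<open>a2\<close> is smaller than all other letters.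
  An Andre II word \<open>u @ a1 # u'\<close> satisfies the same constraint, namely that \<open>a2\<close> lies in \<open>u'\<close>,
  so \<open>phi\<close> is bijective by induction. The three statistics are compared along the same induction,
  using that an Andre I word ends with its maximum. With the conventions for letters
  outside of the word, the equalities hold for words of length 0 and 1 as well, which serve as base.
\<close>

section \<open>Factorization at the minimum letter\<close>

lemma andre_I_distinct: "andre_I w \<Longrightarrow> distinct w"
  by (induction rule: andre_I.induct) auto

lemma andre_II_distinct: "andre_II w \<Longrightarrow> distinct w"
  by (induction rule: andre_II.induct) auto

text \<open>Each of \<open>m\<close>, \<open>m'\<close> occurs in the other factorization, so if
  they differed, each would be smaller than the other. The common letter occurs only once, which
  fixes the factors.\<close>

lemma split_at_min_unique:
  fixes m m' :: "'a::linorder"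
  assumes "u @ m # u' = v @ m' # v'" "\<forall>x\<in>set (u @ u'). m < x" "\<forall>x\<in>set (v @ v'). m' < x"
  shows "u = v \<and> m = m' \<and> u' = v'"
proof -
  have "set (u @ m # u') = set (v @ m' # v')"
    using assms(1) by simp
  then have "m \<in> set (v @ m' # v')" "m' \<in> set (u @ m # u')"
    by (metis in_set_conv_decomp)+
  then have m: "m = m'"
    using assms(2,3) by (auto dest: less_asym)
  have "m \<notin> set u" "m \<notin> set u'" "m \<notin> set v" "m \<notin> set v'"
    using assms(2,3) m by auto
  then show ?thesis
    using assms(1) m by (simp add: append_Cons_eq_iff)
qed

lemma obtain_min_split:
  assumes "distinct w" "w \<noteq> []"
  obtains v m v' where "w = v @ m # v'" "\<forall>x\<in>set (v @ v'). (m::nat) < x"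
proof -
  have "Min (set w) \<in> set w"
    using assms(2) by simp
  then obtain v v' where w: "w = v @ Min (set w) # v'"
    by (meson split_list)
  have "Min (set w) < x" if "x \<in> set (v @ v')" for x
  proof -
    have "distinct (v @ Min (set w) # v')"
      using w assms(1) by simp
    then have "x \<noteq> Min (set w)"
      using that by auto
    moreover have "x \<in> set w"
      using that by (subst w) auto
    ultimately show ?thesis
      by (simp add: order.not_eq_order_implies_strict)
  qed
  then show thesis
    using that w by blast
qed

text \<open>Inverts the rule \<open>split\<close>, by uniqueness of the factorization at the
  minimum. Asking for a dominating letter of \<open>v'\<close> instead of using \<open>Max\<close>
  also covers \<open>v = v' = []\<close>.\<close>

lemma andre_I_split_iff:
  assumes "distinct (v @ m # v')" "\<forall>x\<in>set (v @ v'). m < x"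
  shows "andre_I (v @ m # v') \<longleftrightarrow>
    andre_I v \<and> andre_I v' \<and> (v = [] \<or> (\<exists>y\<in>set v'. \<forall>x\<in>set v. x < y))"
    (is "?L \<longleftrightarrow> ?R")
proof -
  have Max_iff: "Max (set (v @ v')) \<in> set v' \<longleftrightarrow> v = [] \<or> (\<exists>y\<in>set v'. \<forall>x\<in>set v. x < y)"
    if ne: "v @ v' \<noteq> []"
  proof
    assume M: "Max (set (v @ v')) \<in> set v'"
    have "x < Max (set (v @ v'))" if "x \<in> set v" for x
    proof -
      have "x \<le> Max (set (v @ v'))"
        using that by (intro Max_ge) auto
      moreover have "x \<noteq> Max (set (v @ v'))"
        using that M assms(1) by auto
      ultimately show ?thesis
        by simp
    qed
    then show "v = [] \<or> (\<exists>y\<in>set v'. \<forall>x\<in>set v. x < y)"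
      using M by blast
  next
    assume A: "v = [] \<or> (\<exists>y\<in>set v'. \<forall>x\<in>set v. x < y)"
    have "Max (set (v @ v')) \<in> set (v @ v')"
      using ne by (intro Max_in) auto
    moreover have "y \<le> Max (set (v @ v'))" if "y \<in> set v'" for y
      using that by (intro Max_ge) auto
    ultimately show "Max (set (v @ v')) \<in> set v'"
      using A by (metis Un_iff empty_iff empty_set not_less set_append)
  qed
  show ?thesis
  proof
    assume ?L
    then show ?R
    proof cases
      case empty
      then show ?thesis by simp
    next
      case (single x)
      then show ?thesis
        by (auto simp: append_eq_Cons_conv intro: andre_I.intros)
    next
      case (split u k u')
      have "\<forall>x\<in>set (u @ u'). k < x"
      proof
        fix x assume x: "x \<in> set (u @ u')"
        then have "k \<le> x"
          by (subst split(4)) (intro Min_le, auto)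
        then show "k < x"
          using x split(2) by (auto simp: order.order_iff_strict)
      qed
      then have "u = v \<and> k = m \<and> u' = v'"
        using split_at_min_unique[of u k u' v m v'] split(1) assms(2) by auto
      then show ?thesis
        using split(3,5-7) Max_iff by simp
    qed
  next
    assume R: ?R
    show ?L
    proof (cases "v @ v' = []")
      case True
      then show ?thesis by (simp add: andre_I.single)
    next
      case False
      have "m = Min (set (v @ m # v'))"
        by (rule Min_eqI[symmetric]) (use assms(2) in \<open>auto simp: less_imp_le\<close>)
      then show ?thesis
        using R False Max_iff assms(1) by (intro andre_I.split) auto
    qed
  qed
qed

lemma andre_II_split_iff:
  assumes "distinct (v @ m # v')" "\<forall>x\<in>set (v @ v'). m < x"
  shows "andre_II (v @ m # v') \<longleftrightarrow>
    andre_II v \<and> andre_II v' \<and> (v = [] \<or> (\<exists>y\<in>set v'. \<forall>x\<in>set v. y < x))"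
    (is "?L \<longleftrightarrow> ?R")
proof -
  have Min_iff: "Min (set (v @ v')) \<in> set v' \<longleftrightarrow> v = [] \<or> (\<exists>y\<in>set v'. \<forall>x\<in>set v. y < x)"
    if ne: "v @ v' \<noteq> []"
  proof
    assume M: "Min (set (v @ v')) \<in> set v'"
    have "Min (set (v @ v')) < x" if "x \<in> set v" for x
    proof -
      have "Min (set (v @ v')) \<le> x"
        using that by (intro Min_le) auto
      moreover have "x \<noteq> Min (set (v @ v'))"
        using that M assms(1) by auto
      ultimately show ?thesis
        by simp
    qed
    then show "v = [] \<or> (\<exists>y\<in>set v'. \<forall>x\<in>set v. y < x)"
      using M by blast
  next
    assume A: "v = [] \<or> (\<exists>y\<in>set v'. \<forall>x\<in>set v. y < x)"
    have "Min (set (v @ v')) \<in> set (v @ v')"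
      using ne by (intro Min_in) auto
    moreover have "Min (set (v @ v')) \<le> y" if "y \<in> set v'" for y
      using that by (intro Min_le) auto
    ultimately show "Min (set (v @ v')) \<in> set v'"
      using A by (metis Un_iff empty_iff empty_set not_less set_append)
  qed
  show ?thesis
  proof
    assume ?L
    then show ?R
    proof cases
      case empty
      then show ?thesis by simp
    next
      case (single x)
      then show ?thesis
        by (auto simp: append_eq_Cons_conv intro: andre_II.intros)
    next
      case (split u k u')
      have "\<forall>x\<in>set (u @ u'). k < x"
      proof
        fix x assume x: "x \<in> set (u @ u')"
        then have "k \<le> x"
          by (subst split(4)) (intro Min_le, auto)
        then show "k < x"
          using x split(2) by (auto simp: order.order_iff_strict)
      qed
      then have "u = v \<and> k = m \<and> u' = v'"
        using split_at_min_unique[of u k u' v m v'] split(1) assms(2) by auto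
      then show ?thesis
        using split(3,5-7) Min_iff by simp
    qed
  next
    assume R: ?R
    show ?L
    proof (cases "v @ v' = []")
      case True
      then show ?thesis by (simp add: andre_II.single)
    next
      case False
      have "m = Min (set (v @ m # v'))"
        by (rule Min_eqI[symmetric]) (use assms(2) in \<open>auto simp: less_imp_le\<close>)
      then show ?thesis
        using R False Min_iff assms(1) by (intro andre_II.split) auto
    qed
  qed
qed

section \<open>Decomposition at the two smallest letters\<close>

text \<open>\<open>right\<close> and \<open>left\<close> are forms (i) and (ii) of Andre I words.
  The last premise of each locates the overall maximum: in \<open>a2 # v2\<close> for
  \<open>right\<close>, in \<open>v1\<close> for \<open>left\<close>. Up to the order of letters,
  the other premises agree.\<close>

inductive decomp :: "nat list \<Rightarrow> nat list \<Rightarrow> nat \<Rightarrow> nat list \<Rightarrow> nat \<Rightarrow> nat list \<Rightarrow> bool" where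
  right: "\<lbrakk>distinct (v0 @ a1 # v1 @ a2 # v2); a1 < a2; \<forall>x\<in>set (v0 @ v1 @ v2). a2 < x;
      andre_I v1; andre_I (v0 @ a2 # v2);
      v0 @ v1 = [] \<or> (\<exists>y\<in>set v2. \<forall>x\<in>set (v0 @ v1). x < y)\<rbrakk>
    \<Longrightarrow> decomp (v0 @ a1 # v1 @ a2 # v2) v0 a1 v1 a2 v2"
| left: "\<lbrakk>distinct (v0 @ a2 # v2 @ a1 # v1); a1 < a2; \<forall>x\<in>set (v0 @ v1 @ v2). a2 < x;
      andre_I v1; andre_I (v0 @ a2 # v2);
      \<exists>y\<in>set v1. \<forall>x\<in>set (v0 @ a2 # v2). x < y\<rbrakk>
    \<Longrightarrow> decomp (v0 @ a2 # v2 @ a1 # v1) v0 a1 v1 a2 v2"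

text \<open>Form (i) is rebuilt in two stages, first around \<open>a2\<close>, then around
  \<open>a1\<close>; the letter of \<open>v2\<close> that dominates \<open>v0\<close> and
  \<open>v1\<close> settles both. Form (ii) is a single split at \<open>a1\<close>.\<close>

lemma decomp_andre_I: "decomp w v0 a1 v1 a2 v2 \<Longrightarrow> andre_I w"
proof (induction rule: decomp.induct)
  case (right v0 a1 v1 a2 v2)
  have "andre_I v0" "andre_I v2"
    using andre_I_split_iff[of v0 a2 v2] right by auto
  moreover have "andre_I (v1 @ a2 # v2)"
    using andre_I_split_iff[of v1 a2 v2] right \<open>andre_I v2\<close> by auto
  moreover have "\<forall>x\<in>set (v0 @ v1 @ a2 # v2). a1 < x"
    using right(2,3) by (auto intro: less_trans)
  moreover have "v0 = [] \<or> (\<exists>y\<in>set (v1 @ a2 # v2). \<forall>x\<in>set v0. x < y)"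
    using right(6) by auto
  ultimately show ?case
    using andre_I_split_iff[of v0 a1 "v1 @ a2 # v2"] right(1) by blast
next
  case (left v0 a2 v2 a1 v1)
  have "\<forall>x\<in>set ((v0 @ a2 # v2) @ v1). a1 < x"
    using left(2,3) by (auto intro: less_trans)
  then show ?case
    using andre_I_split_iff[of "v0 @ a2 # v2" a1 v1] left(1,4-6) by simp
qed

text \<open>\<open>a1\<close> is the minimum and \<open>a2\<close> the minimum of what remains. If
  \<open>a2\<close> lies right of \<open>a1\<close>, splitting the right factor at \<open>a2\<close>
  gives form (i); otherwise the condition at \<open>a1\<close> is already that of form (ii).\<close>

lemma andre_I_decomp:
  assumes "andre_I w" "2 \<le> length w"
  obtains v0 a1 v1 a2 v2 where "decomp w v0 a1 v1 a2 v2"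
proof -
  have dw: "distinct w"
    using assms(1) by (rule andre_I_distinct)
  have "w \<noteq> []"
    using assms(2) by auto
  then obtain l a1 r where w: "w = l @ a1 # r" and a1: "\<forall>x\<in>set (l @ r). a1 < x"
    by (rule obtain_min_split[OF dw])
  have "distinct (l @ r)" "l @ r \<noteq> []"
    using dw w assms(2) by auto
  then obtain l' a2 r' where lr: "l @ r = l' @ a2 # r'" and a2: "\<forall>x\<in>set (l' @ r'). a2 < x"
    by (rule obtain_min_split)
  have I: "andre_I l" "andre_I r" "l = [] \<or> (\<exists>y\<in>set r. \<forall>x\<in>set l. x < y)"
    using andre_I_split_iff[of l a1 r] assms(1) dw w a1 by auto
  have "a2 \<in> set (l @ r)"
    using lr by simp
  moreover have a2': "a2 < x" if "x \<in> set (l @ r)" "x \<noteq> a2" for x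
    using that a2 unfolding lr by auto
  ultimately consider "a2 \<in> set r" | "a2 \<in> set l"
    by auto
  then show thesis
  proof cases
    case 1
    then obtain v1 v2 where r: "r = v1 @ a2 # v2"
      by (meson split_list)
    have a12: "a1 < a2" using a1 1 by auto
    have min: "\<forall>x\<in>set (l @ v1 @ v2). a2 < x"
      using a2' dw w r by auto
    have II: "andre_I v1" "andre_I v2" "v1 = [] \<or> (\<exists>y\<in>set v2. \<forall>x\<in>set v1. x < y)"
      using andre_I_split_iff[of v1 a2 v2] I(2) dw w r min by auto
    \<comment> \<open>The split at \<open>a1\<close> supplies a letter above \<open>l\<close>, the
      split at \<open>a2\<close> one above \<open>v1\<close>; a single letter of \<open>v2\<close>
      has to dominate both.\<close>
    have top: "l @ v1 = [] \<or> (\<exists>y\<in>set v2. \<forall>x\<in>set (l @ v1). x < y)"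
    proof (cases "l = []")
      case True
      then show ?thesis using II by simp
    next
      case False
      then obtain y where y: "y \<in> set r" "\<forall>x\<in>set l. x < y"
        using I(3) by auto
      obtain z where "z \<in> set l"
        using False by (cases l) auto
      then have "y \<noteq> a2"
        using y min by (metis Un_iff less_asym set_append)
      then consider "y \<in> set v1" | "y \<in> set v2"
        using y r by auto
      then show ?thesis
      proof cases
        case 1
        \<comment> \<open>A letter of \<open>v2\<close> above \<open>v1\<close> is above
          \<open>y\<close>, hence above \<open>l\<close> too.\<close>
        then obtain z where "z \<in> set v2" "\<forall>x\<in>set v1. x < z"
          using II(3) by auto
        with 1 y(2) have "\<forall>x\<in>set (l @ v1). x < z"
          by (auto intro: less_trans)
        then show ?thesis using \<open>z \<in> set v2\<close> by blast
      next
        case 2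
        show ?thesis
        proof (cases "v1 = []")
          case True
          then show ?thesis using 2 y(2) by auto
        next
          case False
          then obtain z where z: "z \<in> set v2" "\<forall>x\<in>set v1. x < z"
            using II(3) by auto
          have "max y z \<in> set v2"
            using 2 z(1) by (simp add: max_def)
          moreover have "\<forall>x\<in>set (l @ v1). x < max y z"
            using y z by (auto simp: less_max_iff_disj)
          ultimately show ?thesis by blast
        qed
      qed
    qed
    then have "l = [] \<or> (\<exists>y\<in>set v2. \<forall>x\<in>set l. x < y)"
      by auto
    moreover have "distinct (l @ a2 # v2)" "\<forall>x\<in>set (l @ v2). a2 < x"
      using dw w r min by auto
    ultimately have "andre_I (l @ a2 # v2)"
      using andre_I_split_iff[of l a2 v2] I(1) II(2) by blast
    then have "decomp (l @ a1 # v1 @ a2 # v2) l a1 v1 a2 v2"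
      using dw w r min a12 II(1) top by (intro decomp.right) auto
    then show thesis
      using that w r by blast
  next
    case 2
    then obtain v0 v2 where l: "l = v0 @ a2 # v2"
      by (meson split_list)
    have "decomp (v0 @ a2 # v2 @ a1 # r) v0 a1 r a2 v2"
      using a1 2 dw w l I a2' by (intro decomp.left) auto
    then show thesis
      using that w l by simp
  qed
qed

text \<open>\<open>phi_right\<close> and \<open>phi_left\<close> need three letters. The only
  shorter word that decomposes is \<open>[a1, a2]\<close>, where both sides are the word
  itself.\<close>

lemma decomp_phi:
  assumes "decomp w v0 a1 v1 a2 v2"
  shows "phi w = phi v1 @ a1 # phi (v0 @ a2 # v2)"
  using assms
proof cases
  case right
  show ?thesis
  proof (cases "3 \<le> length w")
    case True
    then show ?thesis
      using right by (intro phi_right) auto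
  next
    case False
    then have "length (v0 @ v1 @ v2) = 0"
      unfolding right(1) length_append list.size by linarith
    then have "v0 = []" "v1 = []" "v2 = []"
      by simp_all
    then show ?thesis
      using right(1) by (simp add: phi_short)
  qed
next
  case left
  then have "v1 \<noteq> []"
    by auto
  then have "3 \<le> length w"
    using left(1) by (cases v1) auto
  then show ?thesis
    using left by (intro phi_left) auto
qed

lemma decomp_facts:
  assumes "decomp w v0 a1 v1 a2 v2"
  shows "distinct (v0 @ a1 # v1 @ a2 # v2)" "a1 < a2" "\<forall>x\<in>set (v0 @ v1 @ v2). a2 < x"
    "andre_I v1" "andre_I (v0 @ a2 # v2)"
    "set w = set (v1 @ a1 # v0 @ a2 # v2)"
    "length v1 < length w" "length (v0 @ a2 # v2) < length w"
  using assms by (cases; auto)+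

lemma decomp_length: "decomp w v0 a1 v1 a2 v2 \<Longrightarrow> 2 \<le> length w"
  by (induction rule: decomp.induct) auto

text \<open>Induction along the recursion of \<open>phi\<close>. The base is length 1 rather than 2,
  since a two-letter Andre I word decomposes into \<open>v1 = []\<close> and
  \<open>[a2]\<close>.\<close>

lemma andre_I_phi_induct [consumes 1, case_names short decomp]:
  assumes "andre_I w"
    and "\<And>w. length w \<le> 1 \<Longrightarrow> P w"
    and "\<And>w v0 a1 v1 a2 v2. decomp w v0 a1 v1 a2 v2 \<Longrightarrow> P v1 \<Longrightarrow> P (v0 @ a2 # v2) \<Longrightarrow> P w"
  shows "P w"
  using assms(1)
proof (induction w rule: length_induct)
  case (1 w)
  show ?case
  proof (cases "length w \<le> 1")
    case True
    then show ?thesis by (rule assms(2))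
  next
    case False
    then have "2 \<le> length w"
      by simp
    then obtain v0 a1 v1 a2 v2 where d: "decomp w v0 a1 v1 a2 v2"
      by (rule andre_I_decomp[OF 1(2)])
    show ?thesis
      using 1(1) decomp_facts[OF d] by (intro assms(3)[OF d]) auto
  qed
qed

lemma andre_II_short: "length w \<le> 1 \<Longrightarrow> andre_II w"
  by (cases w) (auto intro: andre_II.intros)

lemma andre_I_short: "length w \<le> 1 \<Longrightarrow> andre_I w"
  by (cases w) (auto intro: andre_I.intros)

section \<open>Bijectivity of \<open>phi\<close>\<close>

text \<open>By induction both images are Andre II. The second contains \<open>a2\<close>, which is
  below all letters of the first; this is the Andre II condition at \<open>a1\<close>.\<close>

lemma phi_image: "andre_I w \<Longrightarrow> set (phi w) = set w \<and> andre_II (phi w)"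
proof (induction w rule: andre_I_phi_induct)
  case (short w)
  then show ?case
    by (simp add: phi_short andre_II_short)
next
  case (decomp w v0 a1 v1 a2 v2)
  note f = decomp_facts[OF decomp(1)] and p = decomp_phi[OF decomp(1)]
  have s: "set (phi w) = set w"
    using decomp(2,3) f(6) p by auto
  have "distinct (phi w)"
    using decomp(2,3) f(1-3) p by (auto simp: andre_II_distinct)
  moreover have "\<forall>x\<in>set (phi v1 @ phi (v0 @ a2 # v2)). a1 < x"
    using decomp(2,3) f(2,3) by (auto intro: less_trans)
  ultimately have "andre_II (phi w)"
    unfolding p using decomp(2,3) f(3) by (subst andre_II_split_iff) auto
  with s show ?case ..
qed

lemma phi_eq_Nil: "andre_I w \<Longrightarrow> phi w = [] \<longleftrightarrow> w = []"
  using phi_image[of w] by force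

text \<open>The two forms cannot share their data: (ii) puts a letter of \<open>v1\<close> above all
  of \<open>v2\<close>, whereas (i) with \<open>v1\<close> nonempty puts a letter of
  \<open>v2\<close> above all of \<open>v1\<close>.\<close>

lemma decomp_unique:
  assumes "decomp w v0 a1 v1 a2 v2" "decomp w' v0 a1 v1 a2 v2"
  shows "w = w'"
  using assms(1)
proof cases
  case 1: right
  show ?thesis
    using assms(2)
  proof cases
    case right
    then show ?thesis using 1 by simp
  next
    case left
    then obtain y where y: "y \<in> set v1" "\<forall>x\<in>set (v0 @ a2 # v2). x < y"
      by auto
    then obtain z where "z \<in> set v2" "\<forall>x\<in>set (v0 @ v1). x < z"
      using 1(7) by auto
    with y show ?thesis
      by (metis Un_iff less_asym list.set_intros(2) set_append)
  qed
next
  case 1: left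
  show ?thesis
    using assms(2)
  proof cases
    case left
    then show ?thesis using 1 by simp
  next
    case right
    obtain y where y: "y \<in> set v1" "\<forall>x\<in>set (v0 @ a2 # v2). x < y"
      using 1 by auto
    then obtain z where "z \<in> set v2" "\<forall>x\<in>set (v0 @ v1). x < z"
      using right(7) by auto
    with y show ?thesis
      by (metis Un_iff less_asym list.set_intros(2) set_append)
  qed
qed

text \<open>Splitting \<open>phi w\<close> at its minimum recovers \<open>a1\<close> and the images
  of \<open>v1\<close> and \<open>v0 @ a2 # v2\<close>. Induction recovers these words,
  \<open>a2\<close> is the minimum of the second, and \<open>decomp_unique\<close> gives
  \<open>w\<close>.\<close>

lemma phi_inj:
  assumes "andre_I w" "andre_I w'" "phi w = phi w'"
  shows "w = w'"
  using assms
proof (induction w arbitrary: w' rule: andre_I_phi_induct)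
  case (short w)
  then have "length (phi w') \<le> 1"
    by (simp add: phi_short)
  moreover have "length (phi w') = length w'"
    using phi_image[OF short(2)] short(2)
    by (metis andre_I_distinct andre_II_distinct distinct_card)
  ultimately show ?case
    using short by (simp add: phi_short)
next
  case (decomp w v0 a1 v1 a2 v2)
  note f = decomp_facts[OF decomp(1)] and p = decomp_phi[OF decomp(1)]
  have I: "andre_I w"
    using decomp_andre_I decomp(1) .
  \<comment> \<open>Equal images have equal letter sets, so \<open>w'\<close> is as long as
    \<open>w\<close> and decomposes too.\<close>
  have "set w = set w'"
    using phi_image I decomp.prems by metis
  then have "length w = length w'"
    using I decomp.prems by (metis andre_I_distinct distinct_card)
  then have "2 \<le> length w'"
    using decomp_length[OF decomp(1)] by simp
  then obtain u0 b1 u1 b2 u2 where d: "decomp w' u0 b1 u1 b2 u2"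
    by (rule andre_I_decomp[OF decomp.prems(1)])
  note f' = decomp_facts[OF d] and p' = decomp_phi[OF d]
  have "\<forall>x\<in>set (phi v1 @ phi (v0 @ a2 # v2)). a1 < x"
    using f by (auto simp: phi_image intro: less_trans)
  moreover have "\<forall>x\<in>set (phi u1 @ phi (u0 @ b2 # u2)). b1 < x"
    using f' by (auto simp: phi_image intro: less_trans)
  ultimately have e: "phi v1 = phi u1" "a1 = b1" "phi (v0 @ a2 # v2) = phi (u0 @ b2 # u2)"
    using split_at_min_unique[of "phi v1" a1] decomp.prems(2) p p' by metis+
  have "v1 = u1" "v0 @ a2 # v2 = u0 @ b2 # u2"
    using decomp.IH e f'(4,5) by blast+
  moreover from this(2) have "v0 = u0 \<and> a2 = b2 \<and> v2 = u2"
    using f(3) f'(3) by (intro split_at_min_unique) auto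
  ultimately show ?case
    using decomp_unique[OF decomp(1)] d e(2) by blast
qed

text \<open>Split \<open>u\<close> at its minimum \<open>a1\<close>, take preimages of both factors
  and split the second preimage at its minimum \<open>a2\<close>. The Andre II condition puts
  \<open>a2\<close> below the first preimage; the position of the maximum chooses the form.\<close>

lemma phi_surj:
  assumes "andre_II u"
  shows "\<exists>w. andre_I w \<and> phi w = u"
  using assms
proof (induction u rule: length_induct)
  case (1 u)
  show ?case
  proof (cases "length u \<le> 1")
    case True
    then show ?thesis
      using andre_I_short phi_short by (metis le_trans one_le_numeral)
  next
    case False
    have du: "distinct u"
      using 1(2) by (rule andre_II_distinct)
    have "u \<noteq> []"
      using False by auto
    then obtain l a1 r where u: "u = l @ a1 # r" and a1: "\<forall>x\<in>set (l @ r). a1 < x"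
      by (rule obtain_min_split[OF du])
    have II: "andre_II l" "andre_II r" "l = [] \<or> (\<exists>y\<in>set r. \<forall>x\<in>set l. y < x)"
      using andre_II_split_iff[of l a1 r] 1(2) du u a1 by auto
    have "length l < length u" "length r < length u"
      using u by auto
    then obtain v1 v where v1: "andre_I v1" "phi v1 = l" and v: "andre_I v" "phi v = r"
      using 1(1) II(1,2) by blast
    have s: "set v1 = set l" "set v = set r"
      using phi_image v v1 by metis+
    have "r \<noteq> []"
      using False u II(3) by (cases l) auto
    then have "v \<noteq> []"
      using s by auto
    then obtain v0 a2 v2 where w: "v = v0 @ a2 # v2" and a2: "\<forall>x\<in>set (v0 @ v2). a2 < x"
      by (rule obtain_min_split[OF andre_I_distinct[OF v(1)]])
    have II': "l = [] \<or> (\<exists>y\<in>set v. \<forall>x\<in>set l. y < x)"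
      using II(3) s by auto
    have "\<forall>x\<in>set l. a2 < x"
      using II' a2 unfolding w by (auto intro: less_trans)
    then have a2': "\<forall>x\<in>set (v0 @ v1 @ v2). a2 < x"
      using a2 s by auto
    have a12: "a1 < a2"
      using a1 s w by auto
    have dv: "distinct v1" "distinct v"
      using v v1 andre_I_distinct by auto
    have sd: "set v1 \<inter> set v = {}" "a1 \<notin> set v1" "a1 \<notin> set v"
      using du u s by auto
    have I0: "v0 = [] \<or> (\<exists>y\<in>set v2. \<forall>x\<in>set v0. x < y)"
      using v(1) dv(2) a2 unfolding w by (subst (asm) andre_I_split_iff) auto
    have "\<exists>w. decomp w v0 a1 v1 a2 v2"
    proof (cases "\<exists>y\<in>set v1. \<forall>x\<in>set v. x < y")
      case True
      then have "decomp (v0 @ a2 # v2 @ a1 # v1) v0 a1 v1 a2 v2"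
        using a12 a2' v(1) v1(1) dv sd unfolding w by (intro decomp.left) auto
      then show ?thesis ..
    next
      case False
      \<comment> \<open>Without a letter of \<open>v1\<close> above all of \<open>v\<close>, the
        overall maximum lies in \<open>v\<close>, which calls for form (i).\<close>
      define M where "M = Max (set (v1 @ v))"
      have "M \<in> set (v1 @ v)"
        unfolding M_def using \<open>v \<noteq> []\<close> by (intro Max_in) auto
      moreover have M: "x \<le> M" if "x \<in> set (v1 @ v)" for x
        unfolding M_def using that by (intro Max_ge) auto
      moreover have "M \<notin> set v1"
      proof
        assume "M \<in> set v1"
        moreover have "x < M" if "x \<in> set v" for x
          using M[of x] that \<open>M \<in> set v1\<close> sd(1) by (auto simp: order.order_iff_strict)
        ultimately show False
          using False by blast
      qed
      ultimately have Mv: "M \<in> set v"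
        by auto
      have "v0 @ v1 = [] \<or> (\<exists>y\<in>set v2. \<forall>x\<in>set (v0 @ v1). x < y)"
      proof (cases "M \<in> set v2")
        case True
        have "x < M" if "x \<in> set (v0 @ v1)" for x
          using M[of x] that True sd(1) dv(2) w by (auto simp: order.order_iff_strict)
        then show ?thesis using True by blast
      next
        \<comment> \<open>Unless \<open>v0\<close> is empty, \<open>v2\<close> has a letter above
          all of it, so the maximum can only be \<open>a2\<close>. As \<open>a2\<close> is also
          below all letters of \<open>v0\<close> and \<open>v1\<close>, these are empty.\<close>
        case Mv2: False
        have "M \<notin> set v0"
        proof
          assume "M \<in> set v0"
          then obtain y where "y \<in> set v2" "M < y"
            using I0 by auto
          then show False
            using M[of y] w by auto
        qed
        then have "M = a2"
          using Mv Mv2 w by auto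
        then have "set (v0 @ v1) = {}"
          using M a2' w by (metis Un_iff equals0I not_less set_append)
        then show ?thesis by simp
      qed
      then have "decomp (v0 @ a1 # v1 @ a2 # v2) v0 a1 v1 a2 v2"
        using a12 a2' v(1) v1(1) dv sd unfolding w by (intro decomp.right) auto
      then show ?thesis ..
    qed
    then obtain x where "decomp x v0 a1 v1 a2 v2" ..
    then show ?thesis
      using decomp_phi decomp_andre_I v v1 u w by metis
  qed
qed

lemma phi_bij_betw: "bij_betw phi (And_I X) (And_II X)"
proof (rule bij_betw_imageI)
  show "inj_on phi (And_I X)"
    by (auto simp: inj_on_def And_I_def intro: phi_inj)
  show "phi ` And_I X = And_II X"
  proof
    show "phi ` And_I X \<subseteq> And_II X"
      by (auto simp: And_I_def And_II_def phi_image andre_II_distinct)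
    show "And_II X \<subseteq> phi ` And_I X"
    proof
      fix u assume u: "u \<in> And_II X"
      then obtain w where w: "andre_I w" "phi w = u"
        using phi_surj[of u] unfolding And_II_def by auto
      then have "w \<in> And_I X"
        using u phi_image[of w] by (auto simp: And_I_def And_II_def andre_I_distinct)
      then show "u \<in> phi ` And_I X"
        using w by blast
    qed
  qed
qed

section \<open>The statistics on factorized words\<close>

lemma stat_F_simps [simp]: "stat_F [] = 0" "stat_F (x # xs) = x"
  by (simp_all add: stat_F_def letter_def)

lemma stat_L_Nil [simp]: "stat_L [] = 0"
  by (simp add: stat_L_def letter_def)

lemma stat_L_last: "w \<noteq> [] \<Longrightarrow> stat_L w = last w"
  by (cases w) (simp_all add: stat_L_def letter_def last_conv_nth)

lemma stat_L_append [simp]: "stat_L (u @ v) = (if v = [] then stat_L u else stat_L v)"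
  by (cases "u = []"; cases "v = []") (simp_all add: stat_L_last)

lemma stat_L_Cons: "stat_L (x # v) = (if v = [] then x else stat_L v)"
  by (cases "v = []") (simp_all add: stat_L_last)

text \<open>Reduces \<open>NL\<close> to \<open>L\<close>. For length at most 1,
  \<open>letter w 0 = 0\<close> agrees with \<open>stat_L [] = 0\<close>.\<close>

lemma stat_NL_butlast: "stat_NL w = stat_L (butlast w)"
  by (cases w rule: rev_cases) (auto simp: stat_NL_def stat_L_def letter_def nth_append)

text \<open>Eliminates the definite description: the letter sought precedes the first letter smaller
  than \<open>x\<close>. Since \<open>0 < x\<close>, the value 0 past the end serves as such a
  letter if the word has none.\<close>

lemma stat_spi_Cons:
  assumes "0 < x"
  shows "stat_spi (x # r) = last (x # takeWhile (\<lambda>y. x \<le> y) r)"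
proof -
  define p where "p = takeWhile (\<lambda>y. x \<le> y) r"
  define q where "q = dropWhile (\<lambda>y. x \<le> y) r"
  have r: "r = p @ q"
    by (simp add: p_def q_def)
  have p: "\<forall>y\<in>set p. x \<le> y"
    by (auto simp: p_def dest: set_takeWhileD)
  have q: "q = [] \<or> hd q < x"
    using hd_dropWhile[of "\<lambda>y. x \<le> y" r] by (metis not_le q_def)
  let ?w = "x # r" and ?k = "Suc (length p)"
  have l1: "letter ?w 1 = x"
    by (simp add: letter_def)
  have lp: "x \<le> letter ?w j" if "1 \<le> j" "j \<le> ?k" for j
    using that p by (cases j; cases "j - 1") (auto simp: letter_def r nth_append nth_Cons')
  have lq: "letter ?w (Suc ?k) < x"
    using q assms by (cases q) (auto simp: letter_def r nth_append)
  have "(THE i. 1 \<le> i \<and> i \<le> length ?w \<and> (\<forall>j\<in>{1..i}. letter ?w 1 \<le> letter ?w j) \<and>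
      letter ?w 1 > letter ?w (i + 1)) = ?k"
  proof (rule the_equality)
    show "1 \<le> ?k \<and> ?k \<le> length ?w \<and> (\<forall>j\<in>{1..?k}. letter ?w 1 \<le> letter ?w j) \<and>
        letter ?w 1 > letter ?w (?k + 1)"
      using lp lq l1 by (auto simp: r)
  next
    fix i
    assume i: "1 \<le> i \<and> i \<le> length ?w \<and> (\<forall>j\<in>{1..i}. letter ?w 1 \<le> letter ?w j) \<and>
        letter ?w 1 > letter ?w (i + 1)"
    \<comment> \<open>An earlier index is followed by a letter of \<open>p\<close>, still at least
      \<open>x\<close>; a later one has the letter at \<open>Suc ?k\<close>, below \<open>x\<close>,
      in its range.\<close>
    have "\<not> i < ?k"
      using i lp[of "i + 1"] l1 by auto
    moreover have "\<not> ?k < i"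
      using i lq l1 by (metis Suc_leI atLeastAtMost_iff le_add1 not_less plus_1_eq_Suc)
    ultimately show "i = ?k" by simp
  qed
  then have "stat_spi ?w = letter ?w ?k"
    by (simp add: stat_spi_def)
  also have "\<dots> = last (x # p)"
    by (cases p rule: rev_cases) (simp_all add: letter_def r nth_append)
  finally show ?thesis
    by (simp add: p_def)
qed

lemma stat_spi_Nil [simp]: "stat_spi [] = 0"
  by (simp add: stat_spi_def letter_def)

lemma stat_spi_append_less:
  assumes "u \<noteq> []" "0 \<notin> set u" "a < hd u"
  shows "stat_spi (u @ a # v) = stat_spi u"
proof (cases u)
  case (Cons x r)
  have "a < x"
    using assms(3) Cons by simp
  then have "takeWhile (\<lambda>y. x \<le> y) (r @ a # v) = takeWhile (\<lambda>y. x \<le> y) r"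
    by (induction r) auto
  then show ?thesis
    using Cons assms by (simp add: stat_spi_Cons)
qed (use assms in simp)

lemma stat_spi_min_first:
  assumes "0 < a" "\<forall>x\<in>set v. a < x"
  shows "stat_spi (a # v) = last (a # v)"
proof -
  have "takeWhile (\<lambda>y. a \<le> y) v = v"
    using assms(2) by (simp add: less_imp_le)
  then show ?thesis
    using stat_spi_Cons[OF assms(1), of v] by metis
qed

lemma stat_spi_in_set: "w \<noteq> [] \<Longrightarrow> 0 \<notin> set w \<Longrightarrow> stat_spi w \<in> set w"
  by (cases w) (auto simp: stat_spi_Cons dest!: last_in_set set_takeWhileD split: if_splits)

text \<open>As \<open>a\<close> is the minimum, the recursion passes to \<open>u'\<close>, whose
  last letter is that of the whole word.\<close>

lemma stat_pit_split:
  assumes "\<forall>x\<in>set (u @ u'). a < x" "u' \<noteq> []"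
  shows "stat_pit (u @ a # u') = (if last u' = Max (set (u @ a # u')) then a else stat_pit u')"
proof -
  have m: "Min (set (u @ a # u')) = a"
    by (rule Min_eqI) (use assms(1) in \<open>auto simp: less_imp_le\<close>)
  have "a \<notin> set u"
    using assms(1) by auto
  then have "after a (u @ a # u') = u'"
    by (rule after_append)
  moreover have "stat_pit w = (if last w = Max (set w) then Min (set w)
      else stat_pit (after (Min (set w)) w))" if "w \<noteq> []" for w
    using that by (cases w) auto
  ultimately show ?thesis
    using assms(2) m by simp
qed

text \<open>The maximum occurs only once. The value 0 of \<open>stat_L []\<close> and
  \<open>stat_F []\<close> matches the convention at both ends of the word.\<close>

lemma stat_grn_split:
  assumes "\<forall>x\<in>set (p @ q). x < m"
  shows "stat_grn (p @ m # q) = max (stat_L p) (stat_F q)"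
proof -
  let ?w = "p @ m # q" and ?k = "Suc (length p)"
  have M: "Max (set ?w) = m"
    by (rule Max_eqI) (use assms in \<open>auto simp: less_imp_le\<close>)
  have "(THE i. 1 \<le> i \<and> i \<le> length ?w \<and> letter ?w i = Max (set ?w)) = ?k"
  proof (rule the_equality)
    show "1 \<le> ?k \<and> ?k \<le> length ?w \<and> letter ?w ?k = Max (set ?w)"
      unfolding M by (simp add: letter_def)
  next
    fix i assume i: "1 \<le> i \<and> i \<le> length ?w \<and> letter ?w i = Max (set ?w)"
    then have "?w ! (i - 1) = m" "i - 1 < length ?w"
      unfolding M by (auto simp: letter_def)
    moreover have "?w ! j \<in> set (p @ q)" if "j < length ?w" "j \<noteq> length p" for j
      using that by (auto simp: nth_append nth_Cons')
    ultimately have "i - 1 = length p"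
      using assms by (metis less_irrefl)
    then show "i = ?k"
      using i by linarith
  qed
  then have "stat_grn ?w = max (letter ?w (?k - 1)) (letter ?w (?k + 1))"
    by (simp add: stat_grn_def Let_def)
  moreover have "letter ?w (?k - 1) = stat_L p"
    by (cases p rule: rev_cases) (auto simp: letter_def stat_L_last nth_append)
  moreover have "letter ?w (?k + 1) = stat_F q"
    by (cases q) (auto simp: letter_def nth_append)
  ultimately show ?thesis by simp
qed

lemma obtain_max_split:
  assumes "distinct w" "y \<in> set w" "\<forall>x\<in>set w. x \<le> y"
  obtains p q where "w = p @ y # q" "\<forall>x\<in>set (p @ q). (x::nat) < y"
proof -
  obtain p q where w: "w = p @ y # q"
    using assms(2) by (meson split_list)
  have "\<forall>x\<in>set (p @ q). x < y"
    using assms(1,3) unfolding w by (auto simp: order.order_iff_strict)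
  then show thesis
    using that w by blast
qed

text \<open>The right neighbour of the maximum \<open>y\<close> changes only if \<open>y\<close>
  ends \<open>u\<close>, from 0 to \<open>a\<close>; otherwise it already exceeds
  \<open>a\<close>.\<close>

lemma stat_grn_max_left:
  assumes "distinct u" "y \<in> set u" "\<forall>x\<in>set u. x \<le> y"
    and "\<forall>x\<in>set (u @ u'). a < x" "\<forall>x\<in>set u'. x < y"
  shows "stat_grn (u @ a # u') = max (stat_grn u) a"
proof -
  obtain p q where u: "u = p @ y # q" and m: "\<forall>x\<in>set (p @ q). x < y"
    using assms(1-3) by (rule obtain_max_split)
  have "stat_grn (p @ y # (q @ a # u')) = max (stat_L p) (stat_F (q @ a # u'))"
    using m assms(4,5) u by (intro stat_grn_split) auto
  moreover have "stat_grn u = max (stat_L p) (stat_F q)"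
    unfolding u using m by (rule stat_grn_split)
  moreover have "max (stat_L p) (stat_F (q @ a # u')) = max (max (stat_L p) (stat_F q)) a"
    using assms(4) u by (cases q) auto
  ultimately show ?thesis
    using u by simp
qed

text \<open>The left neighbour of \<open>y\<close> changes only if \<open>y\<close> begins
  \<open>u'\<close>, from 0 to \<open>a\<close>. In that case \<open>2 \<le> length u'\<close>
  provides a right neighbour, which exceeds \<open>a\<close>.\<close>

lemma stat_grn_max_right:
  assumes "distinct u'" "y \<in> set u'" "\<forall>x\<in>set u'. x \<le> y" "2 \<le> length u'"
    and "\<forall>x\<in>set (u @ u'). a < x" "\<forall>x\<in>set u. x < y"
  shows "stat_grn (u @ a # u') = stat_grn u'"
proof -
  obtain p q where u: "u' = p @ y # q" and m: "\<forall>x\<in>set (p @ q). x < y"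
    using assms(1-3) by (rule obtain_max_split)
  have "stat_grn ((u @ a # p) @ y # q) = max (stat_L (u @ a # p)) (stat_F q)"
    using m assms(5,6) u by (intro stat_grn_split) auto
  moreover have "stat_grn u' = max (stat_L p) (stat_F q)"
    unfolding u using m by (rule stat_grn_split)
  moreover have "max (stat_L (u @ a # p)) (stat_F q) = max (stat_L p) (stat_F q)"
    using assms(4,5) u by (cases p; cases q) (auto simp: stat_L_Cons)
  ultimately show ?thesis
    using u by simp
qed

text \<open>The overall maximum lies in the factor standing last: \<open>a2 # v2\<close> in form
  (i), \<open>v1\<close> in form (ii). Induction applies to the word ending with it.\<close>

lemma andre_I_last_max: "andre_I w \<Longrightarrow> x \<in> set w \<Longrightarrow> x \<le> last w"
proof (induction arbitrary: x rule: andre_I_phi_induct)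
  case (short w)
  then show ?case by (cases w) auto
next
  case (decomp w v0 a1 v1 a2 v2)
  show ?case
    using decomp(1)
  proof cases
    case right
    have "x \<le> last (v0 @ a2 # v2)" if "x \<in> set (v0 @ a2 # v2)" for x
      using decomp that by blast
    then have l: "x \<le> last (a2 # v2)" if "x \<in> set (v0 @ a2 # v2)" for x
      using that by simp
    have "x \<le> last (a2 # v2)" if "x \<in> set v1" for x
    proof -
      have "\<exists>y\<in>set v2. x < y"
        using that right(7) by auto
      then obtain y where "y \<in> set v2" "x < y"
        by blast
      then show ?thesis
        using l[of y] by auto
    qed
    moreover have "a1 \<le> last (a2 # v2)"
      using l[of a2] right(3) by simp
    ultimately have "x \<le> last (a2 # v2)"
      using l decomp.prems unfolding right(1) by auto
    then show ?thesis
      by (simp add: right(1))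
  next
    case left
    obtain y where y: "y \<in> set v1" "\<forall>x\<in>set (v0 @ a2 # v2). x < y"
      using left(7) by auto
    have "y \<le> last v1" "v1 \<noteq> []"
      using y decomp.IH by auto
    then have "x \<le> last v1"
      using y(2) decomp.IH(1)[of x] decomp.prems left(3) unfolding left(1)
      by (auto dest!: bspec[of _ _ x])
    then show ?thesis
      using \<open>v1 \<noteq> []\<close> by (simp add: left(1))
  qed
qed

section \<open>Comparison of the statistics\<close>

text \<open>With \<open>?v = v0 @ a2 # v2\<close>, the last letter of \<open>phi w\<close> is
  \<open>stat_spi ?v\<close> by induction. The test in \<open>stat_pit\<close> asks whether it is
  the maximum, which happens exactly when \<open>w\<close> begins with \<open>a1\<close>.
  \<open>grn\<close> is read off the image containing the maximum. Letters are positive so that the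
  conventional 0 lies below all of them.\<close>

lemma phi_statistics:
  assumes "andre_I w" "0 \<notin> set w"
  shows "stat_F w = stat_pit (phi w) \<and> stat_spi w = stat_L (phi w) \<and> stat_NL w = stat_grn (phi w)"
  using assms
proof (induction w rule: andre_I_phi_induct)
  case (short w)
  show ?case
  proof (cases w)
    case Nil
    have "letter [] i = 0" for i
      by (simp add: letter_def)
    then show ?thesis
      using Nil by (simp add: phi_short stat_NL_butlast stat_grn_def Let_def)
  next
    case (Cons x r)
    then show ?thesis
      using short stat_grn_split[of "[]" "[]" x]
      by (simp add: phi_short stat_NL_butlast stat_spi_Cons stat_L_Cons)
  qed
next
  case (decomp w v0 a1 v1 a2 v2)
  note f = decomp_facts[OF decomp(1)] and p = decomp_phi[OF decomp(1)]
  let ?v = "v0 @ a2 # v2"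
  have IH: "stat_F ?v = stat_pit (phi ?v)" "stat_spi ?v = stat_L (phi ?v)"
    "stat_NL ?v = stat_grn (phi ?v)" "stat_NL v1 = stat_grn (phi v1)"
    using decomp f(6) by auto
  have s: "set (phi v1) = set v1" "set (phi ?v) = set ?v"
    using f phi_image by blast+
  have d: "distinct (phi v1)" "distinct (phi ?v)"
    using f phi_image andre_II_distinct by blast+
  have ne: "phi ?v \<noteq> []"
    using f(5) phi_eq_Nil by blast
  have a1: "\<forall>x\<in>set (phi v1 @ phi ?v). a1 < x"
    using f(2,3) s by (auto intro: less_trans)
  have pos: "0 < a1" "0 < a2" "0 \<notin> set v0" "0 \<notin> set ?v" "0 \<notin> set v1"
    using decomp.prems f(6) by auto
  have L: "stat_L (phi w) = stat_spi ?v"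
    using ne IH(2) by (simp add: p stat_L_Cons)
  have lastv: "last (phi ?v) = stat_spi ?v"
    using ne IH(2) by (simp add: stat_L_last)
  have sw: "set (phi v1 @ a1 # phi ?v) = set w"
    using f(6) s by auto
  have pit: "stat_pit (phi w) = (if stat_spi ?v = Max (set w) then a1 else stat_F ?v)"
    unfolding p using stat_pit_split[OF a1 ne] lastv IH(1) sw by simp
  have Max_last: "Max (set w) = last w"
  proof (rule Max_eqI)
    show "last w \<in> set w"
      using decomp_length[OF decomp(1)] by (intro last_in_set) auto
  qed (use andre_I_last_max[OF decomp_andre_I[OF decomp(1)]] in auto)
  show ?case
    using decomp(1)
  proof cases
    case right
    have lw: "last w = last (a2 # v2)"
      using right(1) by simp
    have "stat_F w = stat_pit (phi w) \<and> stat_spi w = stat_L (phi w)"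
    \<comment> \<open>If \<open>v0\<close> is empty, \<open>w\<close> and \<open>?v\<close> start
      with their minima and both \<open>spi\<close> are the last letter. Otherwise both are
      \<open>stat_spi v0\<close>, a letter of \<open>v0\<close>, while the maximum ends
      \<open>w\<close> outside \<open>v0\<close>.\<close>
    proof (cases v0)
      case Nil
      have "stat_spi (a2 # v2) = last (a2 # v2)"
        using pos right(4) by (intro stat_spi_min_first) auto
      moreover have "stat_spi w = last w"
        unfolding right(1) Nil append_Nil using pos right(3,4)
        by (intro stat_spi_min_first) (auto intro: less_trans)
      ultimately show ?thesis
        using pit L lw Nil Max_last right(1) by simp
    next
      case (Cons x r)
      have x: "a1 < hd v0" "a2 < hd v0"
        using right(3,4) Cons by auto
      have "stat_spi ?v = stat_spi v0" "stat_spi w = stat_spi v0"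
        unfolding right(1) using x pos Cons by (intro stat_spi_append_less; auto)+
      moreover have "stat_spi v0 \<in> set v0"
        using pos Cons by (intro stat_spi_in_set) auto
      moreover have "last w \<notin> set v0"
        using f(1) lw last_in_set[of "a2 # v2"] by auto
      ultimately have "stat_spi ?v \<noteq> Max (set w)"
        using Max_last by auto
      then show ?thesis
        using pit L Cons right(1) \<open>stat_spi ?v = stat_spi v0\<close> \<open>stat_spi w = stat_spi v0\<close>
        by simp
    qed
    moreover have "stat_NL w = stat_grn (phi w)"
    \<comment> \<open>For \<open>v2 = []\<close> the word is \<open>[a1, a2]\<close>;
      \<open>?v\<close> is too short for \<open>stat_grn_max_right\<close>, so the value is computed
      directly.\<close>
    proof (cases "v2 = []")
      case True
      then have "v0 = []" "v1 = []"
        using right(7) by auto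
      then show ?thesis
        using True right(1,3) stat_grn_split[of "[a1]" "[]" a2]
        by (simp add: phi_short stat_NL_butlast stat_L_Cons)
    next
      case False
      have "last w \<in> set v2"
        using False lw by simp
      have le: "x \<le> last w" if "x \<in> set w" for x
        using that andre_I_last_max[OF decomp_andre_I[OF decomp(1)]] by blast
      have "stat_grn (phi w) = stat_grn (phi ?v)"
        unfolding p
      proof (rule stat_grn_max_right[where y = "last w"])
        show "last w \<in> set (phi ?v)" "\<forall>x\<in>set (phi ?v). x \<le> last w"
          using \<open>last w \<in> set v2\<close> s le f(6) by auto
        have "length (phi ?v) = length ?v"
          using d(2) s(2) f(1) f(5) by (metis andre_I_distinct distinct_card)
        then show "2 \<le> length (phi ?v)"
          using False by (cases v2) auto
        have "x < last w" if "x \<in> set v1" for x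
          using that le[of x] f(1,6) \<open>last w \<in> set v2\<close>
          by (auto simp: order.order_iff_strict)
        then show "\<forall>x\<in>set (phi v1). x < last w"
          using s by simp
      qed (use d a1 in auto)
      moreover have "stat_NL w = stat_NL ?v"
        using False by (simp add: right(1) stat_NL_butlast butlast_append stat_L_Cons)
      ultimately show ?thesis
        using IH(3) by simp
    qed
    ultimately show ?thesis by blast
  next
    case left
    obtain y where y: "y \<in> set v1" "\<forall>x\<in>set ?v. x < y"
      using left(7) by auto
    have v1: "v1 \<noteq> []"
      using y by auto
    have l: "x \<le> last v1" if "x \<in> set v1" for x
      using that f(4) andre_I_last_max by blast
    have lw: "last w = last v1"
      using v1 left(1) by simp
    have lt: "\<forall>x\<in>set ?v. x < last v1"
      using y l[of y] by (meson less_le_trans)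
    have "stat_spi ?v \<in> set ?v"
      using pos by (intro stat_spi_in_set) auto
    then have "stat_spi ?v \<noteq> Max (set w)"
      using lt lw Max_last by auto
    then have F: "stat_F w = stat_pit (phi w)"
      using pit left(1) by (cases v0) auto
    have "a1 < hd ?v"
      using left(3,4) by (cases v0) auto
    then have "stat_spi (?v @ a1 # v1) = stat_spi ?v"
      using pos by (intro stat_spi_append_less) auto
    then have S: "stat_spi w = stat_L (phi w)"
      using L left(1) by simp
    have "stat_grn (phi w) = max (stat_grn (phi v1)) a1"
      unfolding p by (rule stat_grn_max_left[where y = "last v1"]) (use d a1 s l lt v1 in auto)
    also have "\<dots> = max (stat_NL v1) a1"
      using IH(4) by simp
    also have "\<dots> = stat_NL w"
    \<comment> \<open>If \<open>v1\<close> is a single letter, its \<open>NL\<close> is 0 and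
      \<open>a1\<close> is the last letter but one of \<open>w\<close>. Otherwise that letter lies
      in \<open>v1\<close> and exceeds \<open>a1\<close>.\<close>
    proof (cases "butlast v1 = []")
      case True
      then show ?thesis
        using v1 by (simp add: left(1) stat_NL_butlast butlast_append stat_L_Cons)
    next
      case False
      then have "last (butlast v1) \<in> set v1"
        by (meson in_set_butlastD last_in_set)
      then have "a1 < last (butlast v1)"
        using a1 s by auto
      then show ?thesis
        using v1 False by (simp add: left(1) stat_NL_butlast butlast_append stat_L_Cons stat_L_last)
    qed
    finally show ?thesis
      using F S by simp
  qed
qed

theorem theorem3p3:
  fixes n :: nat
  assumes "2 \<le> n"
  shows "bij_betw phi (And_I {1..n}) (And_II {1..n}) \<and>
    (\<forall>w \<in> And_I {1..n}.
      (stat_F w, stat_spi w, stat_NL w) =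
      (stat_pit (phi w), stat_L (phi w), stat_grn (phi w)))"
  using phi_bij_betw phi_statistics by (auto simp: And_I_def)

end
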